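(* Let $\{x^k\}$, $\{\rho_k\}$ be infinite sequences generated by Algorithm FoNCO (described in the context) applied to problem (NLP), such that Assumptions S and G (stated in the context) hold. Then: (i) Any limit point of $\{x^k\}$ is first-order stationary for $v$, i.e. it is feasible for (NLP) or an infeasible stationary point of (NLP). (ii) If $\rho_k\to\rho_*$ for some constant $\rho_*>0$ and $v(x^k)\to0$, then any limit point $x^*$ of $\{x^k\}$ with $v(x^* )=0$ is a KKT point of (NLP). (iii) If $\rho_k\to0$, then either all limit points of $\{x^k\}$ are feasible for (NLP) or all are infeasible.
   Context: Problem. Let $f:\mathbb{R}^n\to\mathbb{R}$ and $c_i:\mathbb{R}^n\to\mathbb{R}$, $i\in\mathcal{E}\cup\mathcal{I}$ ($\mathcal{E},\mathcal{I}$ disjoint finite index sets), be continuously differentiable. (NLP) is: minimize $f(x)$ over $x\in\mathbb{R}^n$ subject to $c_i(x)=0$ for $i\in\mathcal{E}$ and $c_i(x)\le 0$ for $i\in\mathcal{I}$. Put $(z)_+=\max\{z,0\}$, $v_i(z)=|z|$ for $i\in\mathcal{E}$, $v_i(z)=(z)_+$ for $i\in\mathcal{I}$, $v(x)=\sum_{i\in\mathcal{E}\cup\mathcal{I}}v_i(c_i(x))$, and $\phi(x;\rho)=\rho f(x)+v(x)$. Let $\bar\partial v(x)=\{\sum_i\lambda_i\nabla c_i(x):\lambda_i\in\partial_c v_i(c_i(x))\}$, where $\partial_c v_i$ is the convex subdifferential of $v_i$. A point $x$ is (first-order) stationary for $v$ if $0\in\bar\partial v(x)$, and is an infeasible stationary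 point of (NLP) if moreover $v(x)>0$. Model. $\|\cdot\|$ is a norm on $\mathbb{R}^n$ with dual norm $\|\cdot\|_*$, $\delta>0$ is a fixed trust region radius and $X=\{d:\|d\|\le\delta\}$. For $\rho\ge 0$: $l(d;\rho,x)=\rho\langle\nabla f(x),d\rangle+\sum_i v_i(c_i(x)+\langle\nabla c_i(x),d\rangle)$ and $\Delta l(d;\rho,x)=l(0;\rho,x)-l(d;\rho,x)$. The dual of $\min_{d\in X}l(d;\rho,x)$ is to maximize $p(\lambda;\rho,x)=-\delta\|\rho\nabla f(x)+\sum_i\lambda_i\nabla c_i(x)\|_*+\sum_i\lambda_ic_i(x)$ over dual feasible $\lambda$, i.e. $-1\le\lambda_i\le1$ for $i\in\mathcal{E}$, $0\le\lambda_i\le1$ for $i\in\mathcal{I}$. Algorithm FoNCO. Parameters: $\theta_\alpha,\beta_\alpha,\theta_\rho\in(0,1)$, $0<\beta_v<\beta_\phi<1$, $\beta_l\in(0,\beta_\phi(1-\beta_v)]$, $\rho_{-1}>0$, $\gamma_0\in(0,1)$, starting point $x^0$. At iteration $k=0,1,\dots$: (1) Subproblem solver. Starting from $\rho_{(0)}=\rho_{k-1}$, for $j=0,1,\dots$ generate $(d^{(j)},\lambda^{(j)},\nu^{(j)})$ (primal estimate, and dual estimates for the penalty and the feasibility subproblem). With $l_\gamma=v(x^k)+\gamma_k$ define $r_v^{(j)}=\frac{l_\gamma-l(d^{(j)};0,x^k)}{l_\gamma-(p(\nu^{(j)};0,x^k))_+}$, $r_\phi^{(j)}=\frac{l_\gamma-l(d^{(j)};\rho_{(j)},x^k)}{l_\gamma-p(\lambda^{(j)};\rho_{(j)},x^k)}$,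 $r_c^{(j)}=1-\sqrt{\chi^{(j)}/l_\gamma}$, where, writing $w_i=c_i(x^k)+\langle\nabla c_i(x^k),d^{(j)}\rangle$, $\chi^{(j)}=\sum_{i\in\mathcal{E}\cup\mathcal{I},\,w_i>0}(1-\lambda_i^{(j)})v_i(w_i)+\sum_{i\in\mathcal{E},\,w_i<0}(1+\lambda_i^{(j)})v_i(w_i)$. Conditions: $(R_v)$: $r_v^{(j)}\ge\beta_v$; $(R_\phi)$: $r_\phi^{(j)}\ge\beta_\phi$; $(R_c)$: $r_c^{(j)}\ge\beta_v$. Rule (DUST): if all three hold, terminate; else if $(R_\phi)$ and $(R_c)$ hold but $(R_v)$ does not, set $\rho_{(j+1)}=\theta_\rho\rho_{(j)}$; else $\rho_{(j+1)}=\rho_{(j)}$. On termination set $(d^k,\lambda^k,\nu^k)=(d^{(j)},\lambda^{(j)},\nu^{(j)})$, $\tilde\rho_k=\rho_{(j)}$. (2) Rule (PSST): set $\rho_k=\tilde\rho_k$ if $\Delta l(d^k;\tilde\rho_k,x^k)+\gamma_k\ge\beta_l(\Delta l(d^k;0,x^k)+\gamma_k)$, otherwise $\rho_k=(1-\beta_l)(\Delta l(d^k;0,x^k)+\gamma_k)/\langle\nabla f(x^k),d^k\rangle$. The output is required to satisfy $\Delta l(d^k;\rho_k,x^k)+\gamma_k\ge\beta_\phi[l(0;\rho_k,x^k)-p(\lambda^k;\rho_k,x^k)+\gamma_k]$ and $\Delta l(d^k;0,x^k)+\gamma_k\ge\beta_v[l(0;0,x^k)-p(\lambda^k;0,x^k)+\gamma_k]$.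 (3) Line search: $\alpha_k$ is the largest value in $\{\theta_\alpha^0,\theta_\alpha^1,\dots\}$ with $\phi(x^k;\rho_k)-\phi(x^k+\alpha_kd^k;\rho_k)\ge\beta_\alpha\alpha_k\Delta l(d^k;\rho_k,x^k)$. Set $x^{k+1}=x^k+\alpha_kd^k$ and choose $\gamma_{k+1}\in(0,\gamma_k]$. Assumption S. In every subproblem and for all $j$: $d^{(j)}\in X$; $\lambda^{(j)},\nu^{(j)}$ are dual feasible; $l(d^{(j)};\rho_{(j)},x^k)\le l(0;\rho_{(j)},x^k)$; and $p(\nu^{(j)};0,x^k)\ge p(\lambda^{(j)};0,x^k)\ge p(\lambda^{(0)};0,x^k)>-\infty$. Assumption G. $f$ and all $c_i$, together with their first- and second-order derivatives, are bounded on an open convex set containing $\{x^k\}$ and $\{x^k+d^k\}$; and $\gamma_k\to0$. *)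

theory Defs
  imports "HOL-Analysis.Analysis"
begin

definition grad :: "('a::real_inner \<Rightarrow> real) \<Rightarrow> 'a \<Rightarrow> 'a" where
  "grad h x = (THE D. GDERIV h x :> D)"

definition cont_differentiable :: "('a::euclidean_space \<Rightarrow> real) \<Rightarrow> bool" where
  "cont_differentiable h \<longleftrightarrow>
     (\<forall>x. h differentiable (at x)) \<and> continuous_on UNIV (grad h)"

text \<open>The second-order derivative is the Frechet derivative of the gradient (the Hessian,
  as a linear map); its existence on \<open>U\<close> is part of the condition, its continuity is not.\<close>

definition bounded_up_to_order2 :: "('a::euclidean_space \<Rightarrow> real) \<Rightarrow> 'a set \<Rightarrow> bool" where
  "bounded_up_to_order2 h U \<longleftrightarrow>
     bounded (h ` U) \<and> bounded (grad h ` U) \<and>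
     (\<exists>B. \<forall>x\<in>U. \<exists>H. (grad h has_derivative H) (at x) \<and> onorm H \<le> B)"

definition convex_subdiff :: "('a::real_inner \<Rightarrow> real) \<Rightarrow> 'a \<Rightarrow> 'a set" where
  "convex_subdiff h z = {g. \<forall>y. h z + g \<bullet> (y - z) \<le> h y}"

definition is_norm :: "('a::real_vector \<Rightarrow> real) \<Rightarrow> bool" where
  "is_norm N \<longleftrightarrow>
     (\<forall>x. 0 \<le> N x) \<and> (\<forall>x. N x = 0 \<longleftrightarrow> x = 0) \<and>
     (\<forall>a x. N (a *\<^sub>R x) = \<bar>a\<bar> * N x) \<and> (\<forall>x y. N (x + y) \<le> N x + N y)"

definition dual_norm :: "('a::real_inner \<Rightarrow> real) \<Rightarrow> 'a \<Rightarrow> real" where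
  "dual_norm N y = (SUP x\<in>{x. N x \<le> 1}. y \<bullet> x)"

definition limit_point :: "(nat \<Rightarrow> 'a::topological_space) \<Rightarrow> 'a \<Rightarrow> bool" where
  "limit_point X l \<longleftrightarrow> (\<exists>r::nat \<Rightarrow> nat. strict_mono r \<and> (X \<circ> r) \<longlonglongrightarrow> l)"


record ('a, 'i) nlp =
  obj :: "'a \<Rightarrow> real"
  con :: "'i \<Rightarrow> 'a \<Rightarrow> real"
  eqs :: "'i set"
  ineqs :: "'i set"

definition idx :: "('a, 'i) nlp \<Rightarrow> 'i set" where
  "idx P = eqs P \<union> ineqs P"

definition valid_nlp :: "('a::euclidean_space, 'i) nlp \<Rightarrow> bool" where
  "valid_nlp P \<longleftrightarrow>
     finite (eqs P) \<and> finite (ineqs P) \<and> eqs P \<inter> ineqs P = {} \<and>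
     cont_differentiable (obj P) \<and> (\<forall>i\<in>idx P. cont_differentiable (con P i))"

definition feasible :: "('a, 'i) nlp \<Rightarrow> 'a \<Rightarrow> bool" where
  "feasible P x \<longleftrightarrow> (\<forall>i\<in>eqs P. con P i x = 0) \<and> (\<forall>i\<in>ineqs P. con P i x \<le> 0)"

text \<open>\<open>viol P i\<close>, \<open>infeas P\<close> and \<open>penalty_fun P \<rho> x\<close> are $v_i$, $v$ and $\phi(x;\rho)$. \<open>viol\<close> is meant only for
  \<open>i \<in> idx P\<close>.\<close>

definition viol :: "('a, 'i) nlp \<Rightarrow> 'i \<Rightarrow> real \<Rightarrow> real" where
  "viol P i z = (if i \<in> eqs P then \<bar>z\<bar> else max z 0)"

definition infeas :: "('a, 'i) nlp \<Rightarrow> 'a \<Rightarrow> real" where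
  "infeas P x = (\<Sum>i\<in>idx P. viol P i (con P i x))"

definition penalty_fun :: "('a, 'i) nlp \<Rightarrow> real \<Rightarrow> 'a \<Rightarrow> real" where
  "penalty_fun P \<rho> x = \<rho> * obj P x + infeas P x"

definition infeas_subdiff :: "('a::euclidean_space, 'i) nlp \<Rightarrow> 'a \<Rightarrow> 'a set" where
  "infeas_subdiff P x =
     {(\<Sum>i\<in>idx P. \<mu> i *\<^sub>R grad (con P i) x) | \<mu>.
        \<forall>i\<in>idx P. \<mu> i \<in> convex_subdiff (viol P i) (con P i x)}"

definition stationary_infeas :: "('a::euclidean_space, 'i) nlp \<Rightarrow> 'a \<Rightarrow> bool" where
  "stationary_infeas P x \<longleftrightarrow> 0 \<in> infeas_subdiff P x"

definition infeasible_stationary :: "('a::euclidean_space, 'i) nlp \<Rightarrow> 'a \<Rightarrow> bool" where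
  "infeasible_stationary P x \<longleftrightarrow> stationary_infeas P x \<and> infeas P x > 0"

definition kkt_point :: "('a::euclidean_space, 'i) nlp \<Rightarrow> 'a \<Rightarrow> bool" where
  "kkt_point P x \<longleftrightarrow>
     feasible P x \<and>
     (\<exists>\<mu>. grad (obj P) x + (\<Sum>i\<in>idx P. \<mu> i *\<^sub>R grad (con P i) x) = 0 \<and>
          (\<forall>i\<in>ineqs P. 0 \<le> \<mu> i \<and> \<mu> i * con P i x = 0))"


definition lin_con :: "('a::euclidean_space, 'i) nlp \<Rightarrow> 'a \<Rightarrow> 'i \<Rightarrow> 'a \<Rightarrow> real" where
  "lin_con P x i d = con P i x + grad (con P i) x \<bullet> d"

text \<open>\<open>model P d \<rho> x\<close> is $l(d;\rho,x)$ and \<open>model_red P d \<rho> x\<close> is $\Delta l(d;\rho,x)$.\<close>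

definition model :: "('a::euclidean_space, 'i) nlp \<Rightarrow> 'a \<Rightarrow> real \<Rightarrow> 'a \<Rightarrow> real" where
  "model P d \<rho> x = \<rho> * (grad (obj P) x \<bullet> d) + (\<Sum>i\<in>idx P. viol P i (lin_con P x i d))"

definition model_red :: "('a::euclidean_space, 'i) nlp \<Rightarrow> 'a \<Rightarrow> real \<Rightarrow> 'a \<Rightarrow> real" where
  "model_red P d \<rho> x = model P 0 \<rho> x - model P d \<rho> x"

definition dual_feasible :: "('a, 'i) nlp \<Rightarrow> ('i \<Rightarrow> real) \<Rightarrow> bool" where
  "dual_feasible P \<mu> \<longleftrightarrow>
     (\<forall>i\<in>eqs P. - 1 \<le> \<mu> i \<and> \<mu> i \<le> 1) \<and> (\<forall>i\<in>ineqs P. 0 \<le> \<mu> i \<and> \<mu> i \<le> 1)"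

definition dual_obj ::
  "('a::euclidean_space, 'i) nlp \<Rightarrow> ('a \<Rightarrow> real) \<Rightarrow> real \<Rightarrow> ('i \<Rightarrow> real) \<Rightarrow> real \<Rightarrow> 'a \<Rightarrow> real" where
  "dual_obj P N \<delta> \<mu> \<rho> x =
     - \<delta> * dual_norm N (\<rho> *\<^sub>R grad (obj P) x + (\<Sum>i\<in>idx P. \<mu> i *\<^sub>R grad (con P i) x))
     + (\<Sum>i\<in>idx P. \<mu> i * con P i x)"


text \<open>\<open>rho_init\<close> is $\rho_{-1}$.\<close>

record fonco_params =
  theta_alpha :: real
  beta_alpha :: real
  theta_rho :: real
  beta_v :: real
  beta_phi :: real
  beta_l :: real
  rho_init :: real

definition valid_params :: "fonco_params \<Rightarrow> bool" where
  "valid_params A \<longleftrightarrow>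
     0 < theta_alpha A \<and> theta_alpha A < 1 \<and>
     0 < beta_alpha A \<and> beta_alpha A < 1 \<and>
     0 < theta_rho A \<and> theta_rho A < 1 \<and>
     0 < beta_v A \<and> beta_v A < beta_phi A \<and> beta_phi A < 1 \<and>
     0 < beta_l A \<and> beta_l A \<le> beta_phi A * (1 - beta_v A) \<and>
     0 < rho_init A"

text \<open>\<open>l_gam\<close> is $l_\gamma$, \<open>compl_res\<close> is $\chi^{(j)}$ and the three ratios are $r_v^{(j)}$, $r_\phi^{(j)}$,
  $r_c^{(j)}$; throughout, \<open>x\<close> and \<open>\<gamma>\<close> are the current outer iterate $x^k$ and relaxation $\gamma_k$.\<close>

definition l_gam :: "('a, 'i) nlp \<Rightarrow> 'a \<Rightarrow> real \<Rightarrow> real" where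
  "l_gam P x \<gamma> = infeas P x + \<gamma>"

definition ratio_v ::
  "('a::euclidean_space, 'i) nlp \<Rightarrow> ('a \<Rightarrow> real) \<Rightarrow> real \<Rightarrow> 'a \<Rightarrow> real \<Rightarrow> 'a \<Rightarrow> ('i \<Rightarrow> real) \<Rightarrow> real" where
  "ratio_v P N \<delta> x \<gamma> d \<nu> =
     (l_gam P x \<gamma> - model P d 0 x) / (l_gam P x \<gamma> - max (dual_obj P N \<delta> \<nu> 0 x) 0)"

definition ratio_phi ::
  "('a::euclidean_space, 'i) nlp \<Rightarrow> ('a \<Rightarrow> real) \<Rightarrow> real \<Rightarrow> 'a \<Rightarrow> real \<Rightarrow> real \<Rightarrow> 'a \<Rightarrow> ('i \<Rightarrow> real) \<Rightarrow> real" where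
  "ratio_phi P N \<delta> x \<gamma> \<rho> d \<mu> =
     (l_gam P x \<gamma> - model P d \<rho> x) / (l_gam P x \<gamma> - dual_obj P N \<delta> \<mu> \<rho> x)"

definition compl_res :: "('a::euclidean_space, 'i) nlp \<Rightarrow> 'a \<Rightarrow> 'a \<Rightarrow> ('i \<Rightarrow> real) \<Rightarrow> real" where
  "compl_res P x d \<mu> =
     (\<Sum>i\<in>{i \<in> idx P. lin_con P x i d > 0}. (1 - \<mu> i) * viol P i (lin_con P x i d)) +
     (\<Sum>i\<in>{i \<in> eqs P. lin_con P x i d < 0}. (1 + \<mu> i) * viol P i (lin_con P x i d))"

definition ratio_c :: "('a::euclidean_space, 'i) nlp \<Rightarrow> 'a \<Rightarrow> real \<Rightarrow> 'a \<Rightarrow> ('i \<Rightarrow> real) \<Rightarrow> real" where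
  "ratio_c P x \<gamma> d \<mu> = 1 - sqrt (compl_res P x d \<mu> / l_gam P x \<gamma>)"

text \<open>One call of the subproblem solver, with penalty parameter updates by (DUST): \<open>r j\<close>,
  \<open>d j\<close>, \<open>\<mu> j\<close>, \<open>\<nu> j\<close> are the inner iterates $\rho_{(j)}$, $d^{(j)}$, $\lambda^{(j)}$,
  $\nu^{(j)}$, and \<open>J\<close> is the index at which the solver terminates. Values of these sequences
  beyond \<open>J\<close> carry no meaning and are not constrained.\<close>

definition dust_run ::
  "('a::euclidean_space, 'i) nlp \<Rightarrow> ('a \<Rightarrow> real) \<Rightarrow> real \<Rightarrow> fonco_params \<Rightarrow> 'a \<Rightarrow> real \<Rightarrow> real \<Rightarrow>
   nat \<Rightarrow> (nat \<Rightarrow> real) \<Rightarrow> (nat \<Rightarrow> 'a) \<Rightarrow> (nat \<Rightarrow> 'i \<Rightarrow> real) \<Rightarrow> (nat \<Rightarrow> 'i \<Rightarrow> real) \<Rightarrow> bool" where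
  "dust_run P N \<delta> A x \<gamma> \<rho>prev J r d \<mu> \<nu> \<longleftrightarrow>
     (let Rv = (\<lambda>j. ratio_v P N \<delta> x \<gamma> (d j) (\<nu> j) \<ge> beta_v A);
          Rphi = (\<lambda>j. ratio_phi P N \<delta> x \<gamma> (r j) (d j) (\<mu> j) \<ge> beta_phi A);
          Rc = (\<lambda>j. ratio_c P x \<gamma> (d j) (\<mu> j) \<ge> beta_v A)
      in r 0 = \<rho>prev \<and>
         (\<forall>j<J. \<not> (Rv j \<and> Rphi j \<and> Rc j) \<and>
            r (Suc j) = (if Rphi j \<and> Rc j \<and> \<not> Rv j then theta_rho A * r j else r j)) \<and>
         Rv J \<and> Rphi J \<and> Rc J)"

definition psst ::
  "('a::euclidean_space, 'i) nlp \<Rightarrow> fonco_params \<Rightarrow> 'a \<Rightarrow> real \<Rightarrow> 'a \<Rightarrow> real \<Rightarrow> real" where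
  "psst P A x \<gamma> d \<rho>t =
     (if model_red P d \<rho>t x + \<gamma> \<ge> beta_l A * (model_red P d 0 x + \<gamma>) then \<rho>t
      else (1 - beta_l A) * (model_red P d 0 x + \<gamma>) / (grad (obj P) x \<bullet> d))"

definition output_ok ::
  "('a::euclidean_space, 'i) nlp \<Rightarrow> ('a \<Rightarrow> real) \<Rightarrow> real \<Rightarrow> fonco_params \<Rightarrow> 'a \<Rightarrow> real \<Rightarrow> real \<Rightarrow> 'a \<Rightarrow>
   ('i \<Rightarrow> real) \<Rightarrow> bool" where
  "output_ok P N \<delta> A x \<gamma> \<rho> d \<mu> \<longleftrightarrow>
     model_red P d \<rho> x + \<gamma> \<ge> beta_phi A * (model P 0 \<rho> x - dual_obj P N \<delta> \<mu> \<rho> x + \<gamma>) \<and>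
     model_red P d 0 x + \<gamma> \<ge> beta_v A * (model P 0 0 x - dual_obj P N \<delta> \<mu> 0 x + \<gamma>)"

definition line_search ::
  "('a::euclidean_space, 'i) nlp \<Rightarrow> fonco_params \<Rightarrow> 'a \<Rightarrow> real \<Rightarrow> 'a \<Rightarrow> real \<Rightarrow> bool" where
  "line_search P A x \<rho> d \<alpha> \<longleftrightarrow>
     (let S = {a. (\<exists>m::nat. a = theta_alpha A ^ m) \<and>
                  penalty_fun P \<rho> x - penalty_fun P \<rho> (x + a *\<^sub>R d)
                    \<ge> beta_alpha A * a * model_red P d \<rho> x}
      in \<alpha> \<in> S \<and> (\<forall>a\<in>S. a \<le> \<alpha>))"

text \<open>The data of an infinite run: outer iterates \<open>x\<close>, \<open>\<rho>\<close>, \<open>\<gamma>\<close>, \<open>\<alpha>\<close>, and for each outer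
  iteration \<open>k\<close> the inner termination index \<open>J k\<close> and the inner sequences \<open>r k\<close>, \<open>d k\<close>, \<open>\<mu> k\<close>,
  \<open>\<nu> k\<close>. Thus $d^k$, $\lambda^k$, $\nu^k$, $\tilde\rho_k$ are the inner iterates at index
  \<open>J k\<close>.\<close>

definition fonco_run ::
  "('a::euclidean_space, 'i) nlp \<Rightarrow> ('a \<Rightarrow> real) \<Rightarrow> real \<Rightarrow> fonco_params \<Rightarrow>
   (nat \<Rightarrow> 'a) \<Rightarrow> (nat \<Rightarrow> real) \<Rightarrow> (nat \<Rightarrow> real) \<Rightarrow> (nat \<Rightarrow> real) \<Rightarrow> (nat \<Rightarrow> nat) \<Rightarrow>
   (nat \<Rightarrow> nat \<Rightarrow> real) \<Rightarrow> (nat \<Rightarrow> nat \<Rightarrow> 'a) \<Rightarrow>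
   (nat \<Rightarrow> nat \<Rightarrow> 'i \<Rightarrow> real) \<Rightarrow> (nat \<Rightarrow> nat \<Rightarrow> 'i \<Rightarrow> real) \<Rightarrow> bool" where
  "fonco_run P N \<delta> A x \<rho> \<gamma> \<alpha> J r d \<mu> \<nu> \<longleftrightarrow>
     0 < \<gamma> 0 \<and> \<gamma> 0 < 1 \<and>
     (\<forall>k. dust_run P N \<delta> A (x k) (\<gamma> k) (if k = 0 then rho_init A else \<rho> (k - 1))
            (J k) (r k) (d k) (\<mu> k) (\<nu> k) \<and>
          \<rho> k = psst P A (x k) (\<gamma> k) (d k (J k)) (r k (J k)) \<and>
          output_ok P N \<delta> A (x k) (\<gamma> k) (\<rho> k) (d k (J k)) (\<mu> k (J k)) \<and>
          line_search P A (x k) (\<rho> k) (d k (J k)) (\<alpha> k) \<and>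
          x (Suc k) = x k + \<alpha> k *\<^sub>R d k (J k) \<and>
          0 < \<gamma> (Suc k) \<and> \<gamma> (Suc k) \<le> \<gamma> k)"


text \<open>The dual values are real numbers, so $p(\lambda^{(0)};0,x^k) > -\infty$ holds
  automatically.\<close>

definition assumption_S ::
  "('a::euclidean_space, 'i) nlp \<Rightarrow> ('a \<Rightarrow> real) \<Rightarrow> real \<Rightarrow> (nat \<Rightarrow> 'a) \<Rightarrow> (nat \<Rightarrow> nat) \<Rightarrow>
   (nat \<Rightarrow> nat \<Rightarrow> real) \<Rightarrow> (nat \<Rightarrow> nat \<Rightarrow> 'a) \<Rightarrow>
   (nat \<Rightarrow> nat \<Rightarrow> 'i \<Rightarrow> real) \<Rightarrow> (nat \<Rightarrow> nat \<Rightarrow> 'i \<Rightarrow> real) \<Rightarrow> bool" where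
  "assumption_S P N \<delta> x J r d \<mu> \<nu> \<longleftrightarrow>
     (\<forall>k. \<forall>j\<le>J k.
        N (d k j) \<le> \<delta> \<and>
        dual_feasible P (\<mu> k j) \<and> dual_feasible P (\<nu> k j) \<and>
        model P (d k j) (r k j) (x k) \<le> model P 0 (r k j) (x k) \<and>
        dual_obj P N \<delta> (\<nu> k j) 0 (x k) \<ge> dual_obj P N \<delta> (\<mu> k j) 0 (x k) \<and>
        dual_obj P N \<delta> (\<mu> k j) 0 (x k) \<ge> dual_obj P N \<delta> (\<mu> k 0) 0 (x k))"

text \<open>Here \<open>s k\<close> is the step $d^k$.\<close>

definition assumption_G ::
  "('a::euclidean_space, 'i) nlp \<Rightarrow> (nat \<Rightarrow> 'a) \<Rightarrow> (nat \<Rightarrow> 'a) \<Rightarrow> (nat \<Rightarrow> real) \<Rightarrow> bool" where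
  "assumption_G P x s \<gamma> \<longleftrightarrow>
     (\<exists>U. open U \<and> convex U \<and> (\<forall>k. x k \<in> U \<and> x k + s k \<in> U) \<and>
        bounded_up_to_order2 (obj P) U \<and> (\<forall>i\<in>idx P. bounded_up_to_order2 (con P i) U)) \<and>
     \<gamma> \<longlonglongrightarrow> 0"

end

theory Submission
  imports Defs
begin

text \<open>
  The argument has two halves. The first shows that the predicted reduction \<open>\<Delta>l(d\<^sup>k; \<rho>\<^sub>k, x\<^sup>k)\<close>
  tends to zero (\<open>red_tendsto_0\<close>). The penalty parameter never increases and the predicted
  reductions are nonnegative (\<open>dust_run_rho\<close>, \<open>psst_properties\<close>), so if \<open>B\<close> bounds \<open>\<bar>f\<bar>\<close> along the iterates, the
  merit value \<open>\<rho>\<^sub>k (f(x\<^sup>k) + B) + v(x\<^sup>k)\<close> is nonnegative and decreases by at least a multiple of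
  \<open>\<alpha>\<^sub>k \<Delta>l\<close> at each iteration (\<open>shifted_penalty\<close>). Hence it converges and \<open>\<alpha>\<^sub>k \<Delta>l\<close> tends to zero.
  A second-order expansion of the penalty function (\<open>penalty_fun_step_bound\<close>) shows that
  backtracking can only stop below 1 at a step size that is at least proportional to \<open>\<Delta>l\<close>
  (\<open>line_search_step_bound\<close>); therefore \<open>\<Delta>l\<close> itself tends to zero.

  The second half reads off optimality from duality. The tests on the output of the subproblem
  solver, together with the penalty update, bound the duality gaps of both the penalty and the
  feasibility subproblem by multiples of \<open>\<Delta>l + \<gamma>\<^sub>k\<close>, so both gaps vanish. Each gap is a sum of
  nonnegative terms (\<open>duality_gap_eq\<close>): the dual norm of a combination of gradients, and the
  complementarity defects \<open>v\<^sub>i(c\<^sub>i) - \<lambda>\<^sub>i c\<^sub>i\<close>. Multipliers are confined to a compact box, so along a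
  subsequence they converge, and in the limit all these terms are zero (\<open>limit_multipliers\<close>). For
  the feasibility gap the limit says that \<open>0\<close> belongs to the subdifferential of \<open>v\<close>, which is
  stationarity; for the penalty gap with \<open>\<rho>\<^sub>k \<rightarrow> \<rho>\<^sub>* > 0\<close> it gives, after division by \<open>\<rho>\<^sub>*\<close>, the KKT
  conditions at a feasible limit point.

  Finally, if \<open>\<rho>\<^sub>k \<rightarrow> 0\<close> the contribution of \<open>f\<close> to the convergent merit value disappears, so
  \<open>v(x\<^sup>k)\<close> converges (\<open>infeas_convergent\<close>). By continuity \<open>v\<close> takes the same value at all limit
  points, hence they are all feasible or all infeasible.
\<close>

section \<open>Norms and dual norms on Euclidean space\<close>

lemma is_norm_le_norm:
  fixes N :: "'a::euclidean_space \<Rightarrow> real"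
  assumes "is_norm N"
  obtains C where "C > 0" "\<And>x. N x \<le> C * norm x"
proof -
  have N0: "N 0 = 0" and Nadd: "\<And>x y. N (x + y) \<le> N x + N y" and Nsc: "\<And>a x. N (a *\<^sub>R x) = \<bar>a\<bar> * N x"
    and Npos: "\<And>x. 0 \<le> N x"
    using assms by (auto simp: is_norm_def)
  have Nsum: "N (sum f F) \<le> (\<Sum>b\<in>F. N (f b))" if "finite F" for f and F :: "'a set"
    using that
  proof (induction F)
    case (insert b F)
    then show ?case using Nadd[of "f b" "sum f F"] by simp
  qed (simp add: N0)
  define C where "C = 1 + (\<Sum>b\<in>Basis. N b)"
  have "N x \<le> C * norm x" for x
  proof -
    have "N x = N (\<Sum>b\<in>Basis. (x \<bullet> b) *\<^sub>R b)" by (simp add: euclidean_representation)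
    also have "\<dots> \<le> (\<Sum>b\<in>Basis. N ((x \<bullet> b) *\<^sub>R b))" by (rule Nsum) simp
    also have "\<dots> \<le> (\<Sum>b\<in>Basis. norm x * N b)"
      by (intro sum_mono) (simp add: Nsc mult_right_mono Npos Basis_le_norm)
    also have "\<dots> \<le> C * norm x" by (simp add: C_def sum_distrib_left algebra_simps)
    finally show ?thesis .
  qed
  moreover have "C > 0" unfolding C_def using sum_nonneg[of Basis N] Npos by (simp add: add_pos_nonneg)
  ultimately show ?thesis using that by blast
qed

text \<open>The previous bound makes \<open>N\<close> Lipschitz, hence it attains a positive minimum on the compact
  Euclidean unit sphere; homogeneity extends the resulting bound to the whole space.\<close>

lemma norm_le_is_norm:
  fixes N :: "'a::euclidean_space \<Rightarrow> real"
  assumes "is_norm N"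
  obtains K where "K > 0" "\<And>x. norm x \<le> K * N x"
proof -
  have Nadd: "\<And>x y. N (x + y) \<le> N x + N y" and Nsc: "\<And>a x. N (a *\<^sub>R x) = \<bar>a\<bar> * N x"
    and Npos: "\<And>x. 0 \<le> N x" and N0: "\<And>x. N x = 0 \<longleftrightarrow> x = 0"
    using assms by (auto simp: is_norm_def)
  obtain C where C: "C > 0" "\<And>x. N x \<le> C * norm x"
    using is_norm_le_norm[OF assms] by blast
  have "C-lipschitz_on UNIV N"
  proof (rule lipschitz_onI)
    fix x y
    have "N x \<le> N y + N (x - y)" "N y \<le> N x + N (y - x)"
      using Nadd[of y "x - y"] Nadd[of x "y - x"] by auto
    moreover have "N (x - y) \<le> C * norm (x - y)" "N (y - x) \<le> C * norm (x - y)"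
      using C(2)[of "x - y"] C(2)[of "y - x"] by (auto simp: norm_minus_commute)
    ultimately show "dist (N x) (N y) \<le> C * dist x y"
      by (simp add: dist_norm abs_le_iff)
  qed (use C in simp)
  then have "continuous_on (sphere 0 1) N"
    using lipschitz_on_continuous_on continuous_on_subset by blast
  moreover have "sphere (0::'a) 1 \<noteq> {}" by simp
  ultimately obtain u where u: "u \<in> sphere 0 1" "\<And>y. y \<in> sphere 0 1 \<Longrightarrow> N u \<le> N y"
    using continuous_attains_inf[of "sphere 0 1" N] by auto
  have Nu: "N u > 0" using u(1) N0[of u] Npos[of u] by (auto simp: less_le)
  have "norm x \<le> (1 / N u) * N x" for x
  proof (cases "x = 0")
    case False
    have "N u \<le> N ((1 / norm x) *\<^sub>R x)" using False by (intro u(2)) simp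
    then show ?thesis using False Nu by (simp add: Nsc field_simps)
  qed (simp add: Npos Nu)
  then show ?thesis using that[of "1 / N u"] Nu by auto
qed

text \<open>Testing the supremum that defines the dual norm at the direction \<open>y\<close> itself, scaled to the unit
  sphere of \<open>N\<close>, gives \<open>\<parallel>y\<parallel>\<^sup>2 \<le> N y \<cdot> N\<^sub>*(y)\<close>. The supremum is finite because a multiple of
  \<open>N\<close> dominates the Euclidean norm.\<close>

lemma norm_le_dual_norm:
  fixes N :: "'a::euclidean_space \<Rightarrow> real"
  assumes "is_norm N"
  obtains C where "C > 0" "\<And>y. norm y \<le> C * dual_norm N y"
proof -
  have Nsc: "\<And>a x. N (a *\<^sub>R x) = \<bar>a\<bar> * N x" and Npos: "\<And>x. 0 \<le> N x" and N0: "\<And>x. N x = 0 \<longleftrightarrow> x = 0"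
    using assms by (auto simp: is_norm_def)
  obtain C where C: "C > 0" "\<And>x. N x \<le> C * norm x"
    using is_norm_le_norm[OF assms] by blast
  obtain K where K: "K > 0" "\<And>x. norm x \<le> K * N x"
    using norm_le_is_norm[OF assms] by blast
  have bdd: "bdd_above ((\<lambda>x. y \<bullet> x) ` {x. N x \<le> 1})" for y
  proof (rule bdd_aboveI2)
    fix x assume "x \<in> {x. N x \<le> 1}"
    then have "K * N x \<le> K * 1" using K(1) by (intro mult_left_mono) auto
    then have "norm x \<le> K" using K(2)[of x] by linarith
    then show "y \<bullet> x \<le> norm y * K"
      using norm_cauchy_schwarz[of y x] mult_left_mono[of "norm x" K "norm y"] by simp
  qed
  have "norm y \<le> C * dual_norm N y" for y
  proof (cases "y = 0")
    case True
    have "y \<bullet> 0 \<le> dual_norm N y"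
      unfolding dual_norm_def by (rule cSUP_upper[OF _ bdd]) (use N0[of 0] in simp)
    then show ?thesis using True C by simp
  next
    case False
    then have Ny: "N y > 0" using N0[of y] Npos[of y] by simp
    have "y \<bullet> ((1 / N y) *\<^sub>R y) \<le> dual_norm N y"
      unfolding dual_norm_def by (rule cSUP_upper[OF _ bdd]) (use Ny in \<open>simp add: Nsc\<close>)
    then have 1: "norm y * norm y \<le> N y * dual_norm N y"
      using Ny by (simp add: dot_square_norm power2_eq_square field_simps)
    then have "0 \<le> dual_norm N y"
      using Ny by (metis mult_nonneg_nonneg norm_ge_zero order_trans zero_le_mult_iff not_less)
    then have "norm y * norm y \<le> (C * norm y) * dual_norm N y"
      using 1 C(2)[of y] mult_right_mono by fastforce
    then show ?thesis using False by (simp add: algebra_simps)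
  qed
  then show ?thesis using that C(1) by blast
qed

lemma dual_norm_nonneg:
  fixes N :: "'a::euclidean_space \<Rightarrow> real"
  assumes "is_norm N"
  shows "0 \<le> dual_norm N y"
proof -
  obtain C where C: "C > 0" "norm y \<le> C * dual_norm N y"
    using norm_le_dual_norm[OF assms] by metis
  then have "0 \<le> C * dual_norm N y" using norm_ge_zero[of y] by linarith
  then show ?thesis using C(1) by (simp add: zero_le_mult_iff)
qed

section \<open>Second-order expansions\<close>

lemma has_derivative_grad:
  fixes h :: "'a::euclidean_space \<Rightarrow> real"
  assumes "h differentiable (at x)"
  shows "(h has_derivative (\<lambda>v. grad h x \<bullet> v)) (at x)"
proof -
  from assms obtain D where D: "(h has_derivative D) (at x)"
    by (auto simp: differentiable_def)
  then have "bounded_linear D" by (rule has_derivative_bounded_linear)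
  then have "D = (\<lambda>v. v \<bullet> adjoint D 1)"
    using adjoint_works[of D] by (auto simp: bounded_linear.linear)
  then have "GDERIV h x :> adjoint D 1"
    using D by (simp add: gderiv_def)
  then have "GDERIV h x :> grad h x"
    unfolding grad_def
  proof (rule theI)
    fix g assume "GDERIV h x :> g"
    then have "(\<lambda>v. v \<bullet> g) = (\<lambda>v. v \<bullet> adjoint D 1)"
      using \<open>GDERIV h x :> adjoint D 1\<close> by (auto simp: gderiv_def intro: has_derivative_unique)
    then show "g = adjoint D 1" by (metis vector_eq_ldot)
  qed
  then show ?thesis by (simp add: gderiv_def inner_commute)
qed

text \<open>Bounded second derivatives on a convex set make the gradient Lipschitz there. On the segment from
  \<open>x\<close> to \<open>y\<close> the function \<open>w \<mapsto> h w - \<nabla>h(x) \<cdot> w\<close> then has derivative of norm at most a multiple of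
  \<open>\<parallel>y - x\<parallel>\<close>, and the mean value inequality applies once more.\<close>

lemma quadratic_remainder:
  fixes h :: "'a::euclidean_space \<Rightarrow> real"
  assumes "cont_differentiable h" "bounded_up_to_order2 h U" "convex U"
  obtains L where "L \<ge> 0"
    "\<And>x y. x \<in> U \<Longrightarrow> y \<in> U \<Longrightarrow> \<bar>h y - h x - grad h x \<bullet> (y - x)\<bar> \<le> L * (norm (y - x))\<^sup>2"
proof -
  obtain B where B: "\<And>x. x \<in> U \<Longrightarrow> \<exists>H. (grad h has_derivative H) (at x) \<and> onorm H \<le> B"
    using assms(2) by (auto simp: bounded_up_to_order2_def)
  then obtain H where H: "\<And>x. x \<in> U \<Longrightarrow> (grad h has_derivative H x) (at x)"
    "\<And>x. x \<in> U \<Longrightarrow> onorm (H x) \<le> \<bar>B\<bar>"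
    by (metis abs_ge_self order_trans)
  have lip: "norm (grad h y - grad h x) \<le> \<bar>B\<bar> * norm (y - x)" if "x \<in> U" "y \<in> U" for x y
    using differentiable_bound[OF assms(3), of "grad h" H "\<bar>B\<bar>" y x] H that
    by (auto intro: has_derivative_at_withinI)
  have "\<bar>h y - h x - grad h x \<bullet> (y - x)\<bar> \<le> \<bar>B\<bar> * (norm (y - x))\<^sup>2" if xy: "x \<in> U" "y \<in> U" for x y
  proof -
    let ?S = "closed_segment x y"
    have SU: "?S \<subseteq> U" using closed_segment_subset xy assms(3) by blast
    define q where "q = (\<lambda>w. h w - grad h x \<bullet> w)"
    have 1: "(q has_derivative (\<lambda>v. (grad h w - grad h x) \<bullet> v)) (at w within ?S)" for w
    proof -
      have "(h has_derivative (\<lambda>v. grad h w \<bullet> v)) (at w within ?S)"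
        using assms(1) has_derivative_grad[of h w]
        by (auto simp: cont_differentiable_def intro: has_derivative_at_withinI)
      then show ?thesis unfolding q_def
        by (auto intro!: derivative_eq_intros simp: inner_diff_left)
    qed
    have 2: "onorm (\<lambda>v. (grad h w - grad h x) \<bullet> v) \<le> \<bar>B\<bar> * norm (y - x)" if "w \<in> ?S" for w
    proof (rule onorm_le)
      fix v
      have "norm (w - x) \<le> norm (y - x)"
        using that segment_bound1[of w x y] by simp
      then have "norm (grad h w - grad h x) \<le> \<bar>B\<bar> * norm (y - x)"
        using lip[of x w] that SU xy mult_left_mono[of "norm (w - x)" "norm (y - x)" "\<bar>B\<bar>"] by fastforce
      then show "norm ((grad h w - grad h x) \<bullet> v) \<le> \<bar>B\<bar> * norm (y - x) * norm v"
        using order_trans[OF Cauchy_Schwarz_ineq2[of "grad h w - grad h x" v] mult_right_mono[OF _ norm_ge_zero]]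
        by simp
    qed
    have "norm (q y - q x) \<le> \<bar>B\<bar> * norm (y - x) * norm (y - x)"
      by (rule differentiable_bound[of ?S, OF _ 1 2]) auto
    then show ?thesis
      by (simp add: q_def inner_diff_right power2_eq_square algebra_simps)
  qed
  then show ?thesis using that[of "\<bar>B\<bar>"] by auto
qed

section \<open>Constraint violations and their multipliers\<close>

lemma viol_nonneg: "0 \<le> viol P i z"
  by (simp add: viol_def)

lemma viol_add_le: "viol P i (y + e) \<le> viol P i y + \<bar>e\<bar>"
  by (auto simp: viol_def)

text \<open>Convexity of \<open>v\<^sub>i\<close> makes the model along a direction at least as good as the linear interpolation
  between its end points; this is the form in which a fraction \<open>t\<close> of the step inherits a
  fraction \<open>t\<close> of the predicted reduction.\<close>

lemma viol_convex:
  assumes "0 \<le> t" "t \<le> 1"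
  shows "viol P i (c + t * w) \<le> (1 - t) * viol P i c + t * viol P i (c + w)"
proof -
  have e: "c + t * w = (1 - t) * c + t * (c + w)" by (simp add: algebra_simps)
  have le: "a * b \<le> a * max b 0" if "0 \<le> a" for a b :: real
    using that by (intro mult_left_mono) auto
  show ?thesis
    unfolding e viol_def
    using assms abs_triangle_ineq[of "(1 - t) * c" "t * (c + w)"] le[of "1 - t" c] le[of t "c + w"]
    by (auto simp: abs_mult intro!: add_nonneg_nonneg mult_nonneg_nonneg)
qed

text \<open>The box of dual feasible multipliers is the domain of the conjugates of the \<open>v\<^sub>i\<close>, where the
  conjugates vanish; this is the Fenchel inequality.\<close>

lemma multiplier_le_viol:
  assumes "dual_feasible P \<mu>" "i \<in> idx P" "eqs P \<inter> ineqs P = {}"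
  shows "\<mu> i * z \<le> viol P i z"
proof (cases "i \<in> eqs P")
  case True
  then have "\<bar>\<mu> i\<bar> \<le> 1" using assms by (auto simp: dual_feasible_def)
  then have "\<bar>\<mu> i * z\<bar> \<le> \<bar>z\<bar>" by (simp add: abs_mult mult_left_le_one_le)
  then show ?thesis using True by (simp add: viol_def)
next
  case False
  then have m: "0 \<le> \<mu> i" "\<mu> i \<le> 1" using assms by (auto simp: dual_feasible_def idx_def)
  have "\<mu> i * z \<le> \<mu> i * max z 0" by (rule mult_left_mono) (use m in auto)
  also have "\<dots> \<le> 1 * max z 0" by (rule mult_right_mono) (use m in auto)
  finally show ?thesis using False by (simp add: viol_def)
qed

text \<open>Equality in the Fenchel inequality characterizes subgradients.\<close>

lemma multiplier_in_subdiff: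
  assumes "dual_feasible P \<mu>" "i \<in> idx P" "eqs P \<inter> ineqs P = {}"
    and "viol P i z = \<mu> i * z"
  shows "\<mu> i \<in> convex_subdiff (viol P i) z"
  using multiplier_le_viol[OF assms(1-3)] assms(4)
  by (simp add: convex_subdiff_def algebra_simps)

lemma infeas_nonneg: "0 \<le> infeas P x"
  by (simp add: infeas_def sum_nonneg viol_nonneg)

lemma infeas_eq_0_iff:
  assumes "finite (idx P)" "eqs P \<inter> ineqs P = {}"
  shows "infeas P x = 0 \<longleftrightarrow> feasible P x"
proof -
  have "infeas P x = 0 \<longleftrightarrow> (\<forall>i\<in>idx P. viol P i (con P i x) = 0)"
    unfolding infeas_def using assms(1) by (intro sum_nonneg_eq_0_iff) (auto simp: viol_nonneg)
  also have "\<dots> \<longleftrightarrow> feasible P x"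
    using assms(2) by (fastforce simp: feasible_def viol_def idx_def max_def split: if_splits)
  finally show ?thesis .
qed

text \<open>This splitting is what makes a small gap informative: for dual feasible multipliers both
  parts are nonnegative, so each is bounded by the gap.\<close>

lemma duality_gap_eq:
  "model P 0 \<rho> x - dual_obj P N \<delta> \<mu> \<rho> x =
     \<delta> * dual_norm N (\<rho> *\<^sub>R grad (obj P) x + (\<Sum>i\<in>idx P. \<mu> i *\<^sub>R grad (con P i) x))
     + (\<Sum>i\<in>idx P. viol P i (con P i x) - \<mu> i * con P i x)"
  by (simp add: model_def dual_obj_def lin_con_def sum_subtractf)

section \<open>Limits of multipliers with vanishing duality gap\<close>

text \<open>The Bolzano-Weierstrass theorem for finitely many coordinates of an arbitrary index type,
  refining the subsequence one coordinate at a time.\<close>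

lemma finite_family_convergent_subsequence:
  fixes f :: "nat \<Rightarrow> 'i \<Rightarrow> real"
  assumes "finite I" "\<And>i. i \<in> I \<Longrightarrow> bounded (range (\<lambda>k. f k i))"
  shows "\<exists>s l. strict_mono s \<and> (\<forall>i\<in>I. (\<lambda>k. f (s k) i) \<longlonglongrightarrow> l i)"
  using assms
proof (induction I)
  case empty
  then show ?case using strict_mono_id by blast
next
  case (insert a I)
  then obtain s l where s: "strict_mono s" "\<forall>i\<in>I. (\<lambda>k. f (s k) i) \<longlonglongrightarrow> l i" by auto
  have "bounded (range (\<lambda>k. f (s k) a))"
    by (rule bounded_subset[OF insert.prems[of a]]) auto
  then obtain t m where t: "strict_mono t" "((\<lambda>k. f (s k) a) \<circ> t) \<longlonglongrightarrow> m"
    using bounded_imp_convergent_subsequence by blast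
  have "(\<lambda>k. f ((s \<circ> t) k) i) \<longlonglongrightarrow> (l(a := m)) i" if "i \<in> insert a I" for i
  proof (cases "i = a")
    case False
    then show ?thesis
      using s(2) that LIMSEQ_subseq_LIMSEQ[of "\<lambda>k. f (s k) i" "l i" t] t(1) by (auto simp: o_def)
  qed (use t(2) in \<open>simp add: o_def\<close>)
  then show ?case using strict_mono_o[OF s(1) t(1)] by blast
qed

text \<open>The limit step shared by stationarity and the KKT conditions: for the feasibility subproblem it
  is applied with \<open>\<rho> = 0\<close> throughout, for the penalty subproblem with \<open>\<rho>s > 0\<close>.\<close>

lemma limit_multipliers:
  fixes P :: "('a::euclidean_space, 'i) nlp"
  assumes P: "valid_nlp P" and N: "is_norm N" and \<delta>: "\<delta> > 0"
    and x: "x \<longlonglongrightarrow> z" and \<rho>: "\<rho> \<longlonglongrightarrow> \<rho>s"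
    and feas: "\<And>k. dual_feasible P (\<mu> k)"
    and gap: "(\<lambda>k. model P 0 (\<rho> k) (x k) - dual_obj P N \<delta> (\<mu> k) (\<rho> k) (x k)) \<longlonglongrightarrow> 0"
  obtains l where "dual_feasible P l"
    "\<rho>s *\<^sub>R grad (obj P) z + (\<Sum>i\<in>idx P. l i *\<^sub>R grad (con P i) z) = 0"
    "\<And>i. i \<in> idx P \<Longrightarrow> viol P i (con P i z) = l i * con P i z"
proof -
  have fin: "finite (idx P)" and disj: "eqs P \<inter> ineqs P = {}"
    and smf: "cont_differentiable (obj P)" and smc: "\<And>i. i \<in> idx P \<Longrightarrow> cont_differentiable (con P i)"
    using P by (auto simp: valid_nlp_def idx_def)
  have bd: "\<bar>\<mu> k i\<bar> \<le> 1" if "i \<in> idx P" for k i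
    using feas[of k] that by (auto simp: dual_feasible_def idx_def abs_le_iff)
  have "bounded (range (\<lambda>k. \<mu> k i))" if "i \<in> idx P" for i
    using bd[OF that] by (auto simp: bounded_iff)
  then obtain s l where s: "strict_mono s" "\<And>i. i \<in> idx P \<Longrightarrow> (\<lambda>k. \<mu> (s k) i) \<longlonglongrightarrow> l i"
    using finite_family_convergent_subsequence[OF fin, of \<mu>] by blast
  have xs: "(\<lambda>k. x (s k)) \<longlonglongrightarrow> z" and \<rho>s: "(\<lambda>k. \<rho> (s k)) \<longlonglongrightarrow> \<rho>s"
    using x \<rho> s(1) LIMSEQ_subseq_LIMSEQ by (auto simp: o_def dest: LIMSEQ_subseq_LIMSEQ)
  have lim: "(\<lambda>k. h (x (s k))) \<longlonglongrightarrow> h z" "(\<lambda>k. grad h (x (s k))) \<longlonglongrightarrow> grad h z"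
    if "cont_differentiable h" for h
  proof -
    have "isCont h z" "isCont (grad h) z"
      using that by (auto simp: cont_differentiable_def differentiable_imp_continuous_within
          continuous_on_eq_continuous_at)
    then show "(\<lambda>k. h (x (s k))) \<longlonglongrightarrow> h z" "(\<lambda>k. grad h (x (s k))) \<longlonglongrightarrow> grad h z"
      using xs isCont_tendsto_compose by blast+
  qed
  define D where "D k = \<rho> k *\<^sub>R grad (obj P) (x k) + (\<Sum>i\<in>idx P. \<mu> k i *\<^sub>R grad (con P i) (x k))" for k
  define G where "G k = model P 0 (\<rho> k) (x k) - dual_obj P N \<delta> (\<mu> k) (\<rho> k) (x k)" for k
  define T where "T k i = viol P i (con P i (x k)) - \<mu> k i * con P i (x k)" for k i
  have G_eq: "G k = \<delta> * dual_norm N (D k) + (\<Sum>i\<in>idx P. T k i)" for k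
    unfolding G_def D_def T_def by (rule duality_gap_eq)
  have T_nonneg: "0 \<le> T k i" if "i \<in> idx P" for k i
    using multiplier_le_viol[OF feas that disj] by (simp add: T_def)
  obtain C where C: "C > 0" "\<And>y. norm y \<le> C * dual_norm N y"
    using norm_le_dual_norm[OF N] by blast
  have Gs: "(\<lambda>k. G (s k)) \<longlonglongrightarrow> 0"
    using LIMSEQ_subseq_LIMSEQ[OF gap s(1)] by (simp add: G_def o_def)
  have "dual_feasible P l"
    unfolding dual_feasible_def
  proof (intro conjI ballI)
    fix i assume i: "i \<in> eqs P"
    then have t: "(\<lambda>k. \<mu> (s k) i) \<longlonglongrightarrow> l i" using s(2) by (simp add: idx_def)
    show "- 1 \<le> l i" by (rule LIMSEQ_le_const[OF t]) (use feas i in \<open>auto simp: dual_feasible_def\<close>)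
    show "l i \<le> 1" by (rule LIMSEQ_le_const2[OF t]) (use feas i in \<open>auto simp: dual_feasible_def\<close>)
  next
    fix i assume i: "i \<in> ineqs P"
    then have t: "(\<lambda>k. \<mu> (s k) i) \<longlonglongrightarrow> l i" using s(2) by (simp add: idx_def)
    show "0 \<le> l i" by (rule LIMSEQ_le_const[OF t]) (use feas i in \<open>auto simp: dual_feasible_def\<close>)
    show "l i \<le> 1" by (rule LIMSEQ_le_const2[OF t]) (use feas i in \<open>auto simp: dual_feasible_def\<close>)
  qed
  moreover have "\<rho>s *\<^sub>R grad (obj P) z + (\<Sum>i\<in>idx P. l i *\<^sub>R grad (con P i) z) = 0"
  proof (rule LIMSEQ_unique)
    show "(\<lambda>k. D (s k)) \<longlonglongrightarrow> \<rho>s *\<^sub>R grad (obj P) z + (\<Sum>i\<in>idx P. l i *\<^sub>R grad (con P i) z)"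
      unfolding D_def by (intro tendsto_intros \<rho>s lim smf smc s(2))
    have "norm (D k) \<le> (C / \<delta>) * G k" for k
    proof -
      have "\<delta> * norm (D k) \<le> C * (\<delta> * dual_norm N (D k))"
        using mult_left_mono[OF C(2)[of "D k"], of \<delta>] \<delta> by (simp add: algebra_simps)
      also have "\<dots> \<le> C * G k"
        using C(1) sum_nonneg[OF T_nonneg] by (auto simp: G_eq)
      finally show ?thesis using \<delta> by (simp add: field_simps)
    qed
    moreover have "(\<lambda>k. (C / \<delta>) * G (s k)) \<longlonglongrightarrow> 0"
      using tendsto_mult_left[OF Gs, of "C / \<delta>"] by simp
    ultimately show "(\<lambda>k. D (s k)) \<longlonglongrightarrow> 0"
      by (intro Lim_null_comparison[of "\<lambda>k. D (s k)"]) auto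
  qed
  moreover have "viol P i (con P i z) = l i * con P i z" if i: "i \<in> idx P" for i
  proof -
    have "(\<lambda>k. T (s k) i) \<longlonglongrightarrow> viol P i (con P i z) - l i * con P i z"
      unfolding T_def viol_def
      by (cases "i \<in> eqs P"; simp) (intro tendsto_intros lim smc i s(2))+
    moreover have "norm (T k i) \<le> G k" for k
    proof -
      have "T k i \<le> (\<Sum>i\<in>idx P. T k i)"
        using i fin T_nonneg by (intro member_le_sum) auto
      also have "\<dots> \<le> G k" using dual_norm_nonneg[OF N, of "D k"] \<delta> by (simp add: G_eq)
      finally show ?thesis using T_nonneg[OF i] by simp
    qed
    then have "(\<lambda>k. T (s k) i) \<longlonglongrightarrow> 0"
      using Gs by (intro Lim_null_comparison[of "\<lambda>k. T (s k) i"]) auto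
    ultimately show ?thesis using LIMSEQ_unique by fastforce
  qed
  ultimately show ?thesis using that by blast
qed

section \<open>Decrease of the penalty function along a step\<close>

text \<open>The model replaces \<open>f\<close> and each \<open>c\<^sub>i\<close> by its linearization, with a quadratic error, and each
  \<open>v\<^sub>i\<close> passes on errors without amplification; convexity of the model accounts for the factor
  \<open>t\<close>. One constant serves all \<open>\<rho>\<close> in \<open>[0, R]\<close>, which is needed because \<open>\<rho>\<close> changes between
  iterations.\<close>

lemma penalty_fun_step_bound:
  fixes P :: "('a::euclidean_space, 'i) nlp"
  assumes P: "valid_nlp P" and U: "convex U"
    and f: "bounded_up_to_order2 (obj P) U"
    and c: "\<And>i. i \<in> idx P \<Longrightarrow> bounded_up_to_order2 (con P i) U"
    and R: "R \<ge> 0"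
  obtains C where "C \<ge> 0"
    "\<And>\<rho> x d t. \<lbrakk>0 \<le> \<rho>; \<rho> \<le> R; x \<in> U; x + d \<in> U; 0 \<le> t; t \<le> 1\<rbrakk> \<Longrightarrow>
       penalty_fun P \<rho> (x + t *\<^sub>R d) \<le> penalty_fun P \<rho> x - t * model_red P d \<rho> x + C * t\<^sup>2 * (norm d)\<^sup>2"
proof -
  have smf: "cont_differentiable (obj P)" and smc: "\<And>i. i \<in> idx P \<Longrightarrow> cont_differentiable (con P i)"
    using P by (auto simp: valid_nlp_def)
  obtain Lf where Lf: "Lf \<ge> 0" "\<And>x y. x \<in> U \<Longrightarrow> y \<in> U \<Longrightarrow>
      \<bar>obj P y - obj P x - grad (obj P) x \<bullet> (y - x)\<bar> \<le> Lf * (norm (y - x))\<^sup>2"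
    using quadratic_remainder[OF smf f U] by blast
  have "\<exists>L\<ge>0. \<forall>x\<in>U. \<forall>y\<in>U. \<bar>con P i y - con P i x - grad (con P i) x \<bullet> (y - x)\<bar> \<le> L * (norm (y - x))\<^sup>2"
    if "i \<in> idx P" for i
    using quadratic_remainder[OF smc[OF that] c[OF that] U] by metis
  then obtain Lc where Lc: "\<And>i. i \<in> idx P \<Longrightarrow> Lc i \<ge> 0"
    "\<And>i x y. i \<in> idx P \<Longrightarrow> x \<in> U \<Longrightarrow> y \<in> U \<Longrightarrow>
       \<bar>con P i y - con P i x - grad (con P i) x \<bullet> (y - x)\<bar> \<le> Lc i * (norm (y - x))\<^sup>2"
    by metis
  define C where "C = R * Lf + (\<Sum>i\<in>idx P. Lc i)"
  have "penalty_fun P \<rho> (x + t *\<^sub>R d) \<le> penalty_fun P \<rho> x - t * model_red P d \<rho> x + C * t\<^sup>2 * (norm d)\<^sup>2"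
    if as: "0 \<le> \<rho>" "\<rho> \<le> R" "x \<in> U" "x + d \<in> U" "0 \<le> t" "t \<le> 1" for \<rho> x d t
  proof -
    have "(1 - t) *\<^sub>R x + t *\<^sub>R (x + d) \<in> U"
      using U as by (intro convexD) auto
    then have yU: "x + t *\<^sub>R d \<in> U" by (simp add: algebra_simps)
    let ?q = "t\<^sup>2 * (norm d)\<^sup>2"
    have "obj P (x + t *\<^sub>R d) \<le> obj P x + t * (grad (obj P) x \<bullet> d) + Lf * ?q"
      using Lf(2)[OF as(3) yU] by (simp add: power_mult_distrib)
    then have "\<rho> * obj P (x + t *\<^sub>R d) \<le> \<rho> * (obj P x + t * (grad (obj P) x \<bullet> d) + Lf * ?q)"
      using as(1) by (rule mult_left_mono)
    also have "\<dots> \<le> \<rho> * obj P x + t * (\<rho> * (grad (obj P) x \<bullet> d)) + R * Lf * ?q"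
      using mult_right_mono[OF as(2), of "Lf * ?q"] Lf(1) by (simp add: algebra_simps)
    finally have f_le: "\<rho> * obj P (x + t *\<^sub>R d)
        \<le> \<rho> * obj P x + t * (\<rho> * (grad (obj P) x \<bullet> d)) + R * Lf * ?q" .
    have "viol P i (con P i (x + t *\<^sub>R d))
        \<le> viol P i (con P i x) - t * (viol P i (con P i x) - viol P i (lin_con P x i d)) + Lc i * ?q"
      if i: "i \<in> idx P" for i
    proof -
      let ?g = "grad (con P i) x \<bullet> d"
      let ?e = "con P i (x + t *\<^sub>R d) - con P i x - t * ?g"
      have "\<bar>?e\<bar> \<le> Lc i * ?q"
        using Lc(2)[OF i as(3) yU] by (simp add: power_mult_distrib)
      moreover have "viol P i (con P i (x + t *\<^sub>R d)) \<le> viol P i (con P i x + t * ?g) + \<bar>?e\<bar>"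
        using viol_add_le[of P i "con P i x + t * ?g" ?e] by simp
      ultimately show ?thesis
        using viol_convex[OF as(5,6), of P i "con P i x" ?g]
        by (simp add: lin_con_def algebra_simps)
    qed
    then have "infeas P (x + t *\<^sub>R d) \<le> (\<Sum>i\<in>idx P. viol P i (con P i x)
        - t * (viol P i (con P i x) - viol P i (lin_con P x i d)) + Lc i * ?q)"
      unfolding infeas_def by (rule sum_mono)
    also have "\<dots> = infeas P x - t * (infeas P x - (\<Sum>i\<in>idx P. viol P i (lin_con P x i d)))
        + (\<Sum>i\<in>idx P. Lc i) * ?q"
      by (simp add: infeas_def sum.distrib sum_subtractf sum_distrib_right
          sum_distrib_left[symmetric] right_diff_distrib)
    finally show ?thesis
      using f_le by (simp add: penalty_fun_def model_red_def model_def lin_con_def C_def infeas_def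
          algebra_simps)
  qed
  moreover have "C \<ge> 0" unfolding C_def using R Lf(1) Lc(1) by (simp add: sum_nonneg)
  ultimately show ?thesis using that by blast
qed

text \<open>If backtracking has rejected the trial step size \<open>a = \<alpha> / \<theta>\<close>, then at \<open>a\<close> the quadratic error in
  the expansion must have exceeded the slack \<open>(1 - \<beta>) a \<Delta>l\<close> in the decrease condition, so \<open>a\<close> cannot
  be small compared to \<open>\<Delta>l\<close>.\<close>

lemma line_search_step_bound:
  assumes A: "valid_params A" and ls: "line_search P A x \<rho> d \<alpha>"
    and M: "\<And>t. 0 \<le> t \<Longrightarrow> t \<le> 1 \<Longrightarrow>
      penalty_fun P \<rho> (x + t *\<^sub>R d) \<le> penalty_fun P \<rho> x - t * model_red P d \<rho> x + M * t\<^sup>2"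
  shows "\<alpha> = 1 \<or> theta_alpha A * (1 - beta_alpha A) * model_red P d \<rho> x \<le> M * \<alpha>"
proof (rule disjCI)
  let ?\<theta> = "theta_alpha A" and ?b = "beta_alpha A" and ?m = "model_red P d \<rho> x"
  have \<theta>: "0 < ?\<theta>" "?\<theta> < 1" using A by (auto simp: valid_params_def)
  define S where "S = {a. (\<exists>m::nat. a = ?\<theta> ^ m) \<and>
      penalty_fun P \<rho> x - penalty_fun P \<rho> (x + a *\<^sub>R d) \<ge> ?b * a * ?m}"
  have S: "\<alpha> \<in> S" "\<And>a. a \<in> S \<Longrightarrow> a \<le> \<alpha>"
    using ls by (auto simp: line_search_def Let_def S_def)
  then obtain m where m: "\<alpha> = ?\<theta> ^ m" by (auto simp: S_def)
  assume contra: "\<not> ?\<theta> * (1 - ?b) * ?m \<le> M * \<alpha>"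
  show "\<alpha> = 1"
  proof (rule ccontr)
    assume "\<alpha> \<noteq> 1"
    then obtain n where n: "m = Suc n" using m by (cases m) auto
    define a where "a = ?\<theta> ^ n"
    have a: "0 < a" "a \<le> 1" "\<alpha> = ?\<theta> * a"
      using \<theta> by (auto simp: a_def m n power_le_one)
    then have "\<alpha> < a" using \<theta> by simp
    then have "a \<notin> S" using S(2) by fastforce
    then have "penalty_fun P \<rho> x - penalty_fun P \<rho> (x + a *\<^sub>R d) < ?b * a * ?m"
      by (auto simp: S_def a_def)
    then have "a * ((1 - ?b) * ?m) < a * (M * a)"
      using M[of a] a by (simp add: algebra_simps power2_eq_square)
    then have "(1 - ?b) * ?m < M * a" using a(1) by simp
    then have "?\<theta> * ((1 - ?b) * ?m) < ?\<theta> * (M * a)" using \<theta>(1) by simp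
    then show False using contra a(3) by (simp add: algebra_simps)
  qed
qed

section \<open>The penalty parameter\<close>

lemma dust_run_rho:
  assumes A: "valid_params A" and run: "dust_run P N \<delta> A x \<gamma> \<rho>prev J r d \<mu> \<nu>" and pos: "0 < \<rho>prev"
  shows "0 < r J \<and> r J \<le> \<rho>prev"
proof -
  have \<theta>: "0 < theta_rho A" "theta_rho A < 1" using A by (auto simp: valid_params_def)
  have r0: "r 0 = \<rho>prev" and rS: "\<And>j. j < J \<Longrightarrow> r (Suc j) = theta_rho A * r j \<or> r (Suc j) = r j"
    using run by (auto simp: dust_run_def Let_def split: if_splits)
  have "0 < r j \<and> r j \<le> \<rho>prev" if "j \<le> J" for j
    using that
  proof (induction j)
    case (Suc j)
    then have IH: "0 < r j" "r j \<le> \<rho>prev" by auto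
    then have "0 < theta_rho A * r j" "theta_rho A * r j \<le> r j" using \<theta> by simp_all
    moreover have "r (Suc j) = theta_rho A * r j \<or> r (Suc j) = r j"
      using rS Suc.prems by simp
    ultimately show ?case using IH by linarith
  qed (use r0 pos in simp)
  then show ?thesis by blast
qed

text \<open>When the update triggers, the new parameter is chosen to make the relaxed reduction equal to
  \<open>\<beta>\<^sub>l\<close> times the relaxed feasibility reduction. Nonnegativity of the unrelaxed reduction is then not
  immediate, since \<open>\<gamma>\<close> has been subtracted; it follows because the failed test and the nonnegative
  reduction at \<open>\<rho>t\<close> force \<open>\<gamma>\<close> below the common value. The failed test also makes the slope
  \<open>\<nabla>f \<cdot> d\<close> positive and the new parameter smaller than \<open>\<rho>t\<close>.\<close>

lemma psst_properties:
  assumes A: "valid_params A" and \<gamma>: "0 < \<gamma>" and pos: "0 < \<rho>t"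
    and red: "0 \<le> model_red P d \<rho>t x"
  defines "\<rho> \<equiv> psst P A x \<gamma> d \<rho>t"
  shows "0 < \<rho>" "\<rho> \<le> \<rho>t" "0 \<le> model_red P d \<rho> x"
    "beta_l A * (model_red P d 0 x + \<gamma>) \<le> model_red P d \<rho> x + \<gamma>"
proof -
  let ?b = "beta_l A" and ?m = "model_red P d 0 x + \<gamma>" and ?g = "grad (obj P) x \<bullet> d"
  have "beta_phi A * (1 - beta_v A) < 1 * 1"
    using A by (intro mult_strict_mono) (auto simp: valid_params_def)
  then have b: "0 < ?b" "?b < 1" using A by (auto simp: valid_params_def)
  have mr: "model_red P d q x = model_red P d 0 x - q * ?g" for q
    by (simp add: model_red_def model_def)
  have "0 < \<rho> \<and> \<rho> \<le> \<rho>t \<and> 0 \<le> model_red P d \<rho> x \<and> ?b * ?m \<le> model_red P d \<rho> x + \<gamma>"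
  proof (cases "model_red P d \<rho>t x + \<gamma> \<ge> ?b * ?m")
    case True
    then show ?thesis using pos red by (simp add: \<rho>_def psst_def)
  next
    case False
    then have \<rho>: "\<rho> = (1 - ?b) * ?m / ?g" by (simp add: \<rho>_def psst_def)
    have lt: "model_red P d \<rho>t x + \<gamma> < ?b * ?m" using False by simp
    then have g_lt: "\<gamma> < ?b * ?m" using red by simp
    then have "0 < ?b * ?m" using \<gamma> by linarith
    then have m: "0 < ?m" using b by (simp add: zero_less_mult_iff)
    then have m1: "0 < (1 - ?b) * ?m" using b by simp
    have 2: "(1 - ?b) * ?m < \<rho>t * ?g" using lt by (simp add: mr[of \<rho>t] algebra_simps)
    then have g: "0 < ?g" using m1 pos by (metis less_trans zero_less_mult_pos)
    have "0 < \<rho>" unfolding \<rho> using m1 g by simp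
    moreover have "\<rho> \<le> \<rho>t" unfolding \<rho> using 2 g by (simp add: field_simps)
    moreover have e: "model_red P d \<rho> x + \<gamma> = ?b * ?m"
    proof -
      have "\<rho> * ?g = (1 - ?b) * ?m" unfolding \<rho> using g by simp
      then show ?thesis unfolding mr[of \<rho>] by (simp add: algebra_simps)
    qed
    ultimately show ?thesis using g_lt by simp
  qed
  then show "0 < \<rho>" "\<rho> \<le> \<rho>t" "0 \<le> model_red P d \<rho> x" "?b * ?m \<le> model_red P d \<rho> x + \<gamma>" by auto
qed

section \<open>Descent along an execution\<close>

locale fonco_execution =
  fixes P :: "('a::euclidean_space, 'i) nlp"
    and N :: "'a \<Rightarrow> real"
    and \<delta> :: real
    and A :: fonco_params
    and x :: "nat \<Rightarrow> 'a"
    and \<rho> \<gamma> \<alpha> :: "nat \<Rightarrow> real"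
    and J :: "nat \<Rightarrow> nat"
    and r :: "nat \<Rightarrow> nat \<Rightarrow> real"
    and d :: "nat \<Rightarrow> nat \<Rightarrow> 'a"
    and \<mu> \<nu> :: "nat \<Rightarrow> nat \<Rightarrow> 'i \<Rightarrow> real"
  assumes nlp: "valid_nlp P" and norm_N: "is_norm N" and radius: "0 < \<delta>" and params: "valid_params A"
    and run: "fonco_run P N \<delta> A x \<rho> \<gamma> \<alpha> J r d \<mu> \<nu>"
    and S: "assumption_S P N \<delta> x J r d \<mu> \<nu>"
    and G: "assumption_G P x (\<lambda>k. d k (J k)) \<gamma>"
begin

abbreviation step where "step k \<equiv> d k (J k)"

abbreviation red where "red k \<equiv> model_red P (step k) (\<rho> k) (x k)"

lemma dust_run_step:
    "dust_run P N \<delta> A (x k) (\<gamma> k) (if k = 0 then rho_init A else \<rho> (k - 1)) (J k) (r k) (d k) (\<mu> k) (\<nu> k)"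
  and rho_eq_psst: "\<rho> k = psst P A (x k) (\<gamma> k) (step k) (r k (J k))"
  and output_ok_step: "output_ok P N \<delta> A (x k) (\<gamma> k) (\<rho> k) (step k) (\<mu> k (J k))"
  and line_search_step: "line_search P A (x k) (\<rho> k) (step k) (\<alpha> k)"
  and x_Suc: "x (Suc k) = x k + \<alpha> k *\<^sub>R step k"
  using run unfolding fonco_run_def by blast+

lemma gamma_pos: "0 < \<gamma> k"
  using run unfolding fonco_run_def by (cases k) blast+

lemma trial_rho:
  assumes "0 < (if k = 0 then rho_init A else \<rho> (k - 1))"
  shows "0 < r k (J k) \<and> r k (J k) \<le> (if k = 0 then rho_init A else \<rho> (k - 1))"
  by (rule dust_run_rho[OF params dust_run_step assms])

lemma trial_red_nonneg: "0 \<le> model_red P (step k) (r k (J k)) (x k)"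
  using S by (auto simp: assumption_S_def model_red_def)

text \<open>Positivity has to be carried through the iterations: the trial parameter of iteration \<open>k\<close>
  starts from \<open>\<rho> (k - 1)\<close>, and each update preserves its sign.\<close>

lemma rho_pos: "0 < \<rho> k"
proof (induction k)
  case 0
  then show ?case
    using trial_rho[of 0] params psst_properties(1)[OF params gamma_pos _ trial_red_nonneg]
    by (auto simp: valid_params_def rho_eq_psst[of 0])
next
  case (Suc k)
  then show ?case
    using trial_rho[of "Suc k"] psst_properties(1)[OF params gamma_pos _ trial_red_nonneg]
    by (auto simp: rho_eq_psst[of "Suc k"])
qed

lemma trial_rho_pos: "0 < r k (J k)"
  using trial_rho[of k] params rho_pos by (auto simp: valid_params_def split: if_splits)

lemma rho_le_trial_rho: "\<rho> k \<le> r k (J k)"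
  and red_nonneg: "0 \<le> red k"
  and red_ge_feasibility_red: "beta_l A * (model_red P (step k) 0 (x k) + \<gamma> k) \<le> red k + \<gamma> k"
  using psst_properties[OF params gamma_pos trial_rho_pos trial_red_nonneg, of k k]
  unfolding rho_eq_psst[of k, symmetric] by auto

lemma rho_Suc_le: "\<rho> (Suc k) \<le> \<rho> k"
  using rho_le_trial_rho[of "Suc k"] trial_rho[of "Suc k"] rho_pos[of k] by simp

lemma rho_le_rho_0: "\<rho> k \<le> \<rho> 0"
  using decseq_SucI[of \<rho>, OF rho_Suc_le] by (simp add: decseq_def)

text \<open>Both sides use the parameter of iteration \<open>k\<close>; the change to the next parameter is absorbed in
  \<open>shifted_penalty\<close>.\<close>

lemma sufficient_decrease:
  "\<rho> k * obj P (x (Suc k)) + infeas P (x (Suc k))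
     \<le> \<rho> k * obj P (x k) + infeas P (x k) - beta_alpha A * (\<alpha> k * red k)"
  using line_search_step[of k]
  by (auto simp: x_Suc line_search_def Let_def penalty_fun_def algebra_simps)

lemma step_size_pos: "0 < \<alpha> k"
  using line_search_step[of k] params by (auto simp: line_search_def Let_def valid_params_def)

lemma objective_bounded:
  obtains B where "\<And>k. \<bar>obj P (x k)\<bar> \<le> B"
proof -
  obtain U where U: "\<And>k. x k \<in> U" "bounded (obj P ` U)"
    using G by (auto simp: assumption_G_def bounded_up_to_order2_def)
  have "bounded (range (\<lambda>k. obj P (x k)))"
    by (rule bounded_subset[OF U(2)]) (use U(1) in auto)
  then show ?thesis using that by (auto simp: bounded_iff)
qed

text \<open>Adding \<open>B\<close> makes the objective nonnegative, so that lowering \<open>\<rho>\<close> after the step can only decrease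
  the merit value \<open>E\<close>, and \<open>E\<close> stays bounded below by zero.\<close>

lemma shifted_penalty:
  assumes B: "\<And>k. \<bar>obj P (x k)\<bar> \<le> B"
  defines "E \<equiv> \<lambda>k. \<rho> k * (obj P (x k) + B) + infeas P (x k)"
  shows shifted_penalty_decrease: "beta_alpha A * (\<alpha> k * red k) \<le> E k - E (Suc k)"
    and shifted_penalty_convergent: "convergent E"
proof -
  have fB: "0 \<le> obj P (x k) + B" for k using B[of k] by linarith
  have dec: "beta_alpha A * (\<alpha> k * red k) \<le> E k - E (Suc k)" for k
    using sufficient_decrease[of k] mult_right_mono[OF rho_Suc_le fB, of k "Suc k"]
    by (simp add: E_def algebra_simps)
  then show "beta_alpha A * (\<alpha> k * red k) \<le> E k - E (Suc k)" .
  have "0 \<le> beta_alpha A * (\<alpha> k * red k)" for k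
    using params red_nonneg[of k] step_size_pos[of k] by (simp add: valid_params_def)
  then have "E (Suc k) \<le> E k" for k
    using dec[of k] by (metis diff_ge_0_iff_ge order_trans)
  then have "decseq E" by (rule decseq_SucI)
  moreover have "0 \<le> E k" for k
    unfolding E_def using rho_pos[of k] fB[of k] by (simp add: infeas_nonneg)
  ultimately obtain L where "E \<longlonglongrightarrow> L" using decseq_convergent by metis
  then show "convergent E" by (auto simp: convergent_def)
qed

lemma step_times_red_tendsto_0: "(\<lambda>k. \<alpha> k * red k) \<longlonglongrightarrow> 0"
proof -
  obtain B where B: "\<And>k. \<bar>obj P (x k)\<bar> \<le> B" using objective_bounded by blast
  define E where "E = (\<lambda>k. \<rho> k * (obj P (x k) + B) + infeas P (x k))"
  have dec: "beta_alpha A * (\<alpha> k * red k) \<le> E k - E (Suc k)" for k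
    unfolding E_def by (rule shifted_penalty_decrease[OF B])
  obtain L where E: "E \<longlonglongrightarrow> L"
    using shifted_penalty_convergent[OF B] unfolding convergent_def E_def by blast
  have b: "0 < beta_alpha A" using params by (simp add: valid_params_def)
  have "(\<lambda>k. E k - E (Suc k)) \<longlonglongrightarrow> 0"
    using tendsto_diff[OF E LIMSEQ_Suc[OF E]] by simp
  then have "(\<lambda>k. (E k - E (Suc k)) / beta_alpha A) \<longlonglongrightarrow> 0"
    using tendsto_divide[OF _ tendsto_const, of _ 0 _ "beta_alpha A"] b by fastforce
  moreover have "norm (\<alpha> k * red k) \<le> (E k - E (Suc k)) / beta_alpha A" for k
    using dec[of k] b red_nonneg[of k] step_size_pos[of k] by (simp add: field_simps)
  ultimately show ?thesis by (intro Lim_null_comparison[of "\<lambda>k. \<alpha> k * red k"]) auto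
qed

text \<open>Either the full step is taken, and then \<open>\<Delta>l = \<alpha>\<^sub>k \<Delta>l\<close>, or \<open>\<alpha>\<^sub>k\<close> is at least proportional to
  \<open>\<Delta>l\<close>, and then \<open>\<Delta>l\<^sup>2\<close> is at most a multiple of \<open>\<alpha>\<^sub>k \<Delta>l\<close>. A single bound on \<open>\<Delta>l\<^sup>2\<close> covers both cases.\<close>

lemma red_tendsto_0: "red \<longlonglongrightarrow> 0"
proof -
  obtain U where U: "convex U" "\<And>k. x k \<in> U" "\<And>k. x k + step k \<in> U" "bounded_up_to_order2 (obj P) U"
    "\<And>i. i \<in> idx P \<Longrightarrow> bounded_up_to_order2 (con P i) U"
    using G by (auto simp: assumption_G_def)
  obtain C where C: "C \<ge> 0"
    "\<And>p y s t. \<lbrakk>0 \<le> p; p \<le> \<rho> 0; y \<in> U; y + s \<in> U; 0 \<le> t; t \<le> 1\<rbrakk> \<Longrightarrow>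
       penalty_fun P p (y + t *\<^sub>R s) \<le> penalty_fun P p y - t * model_red P s p y + C * t\<^sup>2 * (norm s)\<^sup>2"
    using penalty_fun_step_bound[OF nlp U(1,4,5), of "\<rho> 0"] rho_pos[of 0] by (metis less_imp_le)
  obtain K where K: "K > 0" "\<And>y. norm y \<le> K * N y" using norm_le_is_norm[OF norm_N] by blast
  define M where "M = C * (K * \<delta>)\<^sup>2"
  define c where "c = theta_alpha A * (1 - beta_alpha A)"
  have c: "0 < c" using params by (simp add: c_def valid_params_def)
  have step_le: "norm (step k) \<le> K * \<delta>" for k
  proof -
    have "N (step k) \<le> \<delta>" using S by (auto simp: assumption_S_def)
    then show ?thesis using K(2)[of "step k"] mult_left_mono[of "N (step k)" \<delta> K] K(1) by linarith
  qed
  have alt: "\<alpha> k = 1 \<or> c * red k \<le> M * \<alpha> k" for k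
    unfolding c_def
  proof (rule line_search_step_bound[OF params])
    show "line_search P A (x k) (\<rho> k) (step k) (\<alpha> k)" by (rule line_search_step)
  next
    fix t :: real assume t: "0 \<le> t" "t \<le> 1"
    have "(norm (step k))\<^sup>2 \<le> (K * \<delta>)\<^sup>2" using step_le[of k] by (intro power_mono) auto
    then have "C * t\<^sup>2 * (norm (step k))\<^sup>2 \<le> C * t\<^sup>2 * (K * \<delta>)\<^sup>2"
      using C(1) by (intro mult_left_mono) auto
    then show "penalty_fun P (\<rho> k) (x k + t *\<^sub>R step k)
        \<le> penalty_fun P (\<rho> k) (x k) - t * red k + M * t\<^sup>2"
      using C(2)[of "\<rho> k" "x k" "step k" t] t U rho_pos[of k] rho_le_rho_0[of k]
      by (simp add: M_def algebra_simps)
  qed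
  have "(red k)\<^sup>2 \<le> (\<alpha> k * red k)\<^sup>2 + (M / c) * (\<alpha> k * red k)" for k
  proof -
    have M: "0 \<le> M" using C(1) by (simp add: M_def)
    have ar: "0 \<le> \<alpha> k * red k" using red_nonneg[of k] step_size_pos[of k] by simp
    from alt[of k] show ?thesis
    proof
      assume "\<alpha> k = 1"
      then show ?thesis using M c red_nonneg[of k] by simp
    next
      assume "c * red k \<le> M * \<alpha> k"
      then have "red k * (c * red k) \<le> red k * (M * \<alpha> k)" using red_nonneg by (rule mult_left_mono)
      then have "(red k)\<^sup>2 \<le> (M / c) * (\<alpha> k * red k)"
        using c by (simp add: field_simps power2_eq_square)
      then show ?thesis by (smt (verit) zero_le_power2)
    qed
  qed
  moreover have "(\<lambda>k. (\<alpha> k * red k)\<^sup>2 + (M / c) * (\<alpha> k * red k)) \<longlonglongrightarrow> 0\<^sup>2 + (M / c) * 0"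
    by (intro tendsto_intros step_times_red_tendsto_0)
  ultimately have "(\<lambda>k. (red k)\<^sup>2) \<longlonglongrightarrow> 0"
    by (intro Lim_null_comparison[of "\<lambda>k. (red k)\<^sup>2"]) auto
  then show ?thesis using tendsto_real_sqrt[of "\<lambda>k. (red k)\<^sup>2" 0] red_nonneg by simp
qed

section \<open>Vanishing duality gaps and limit points\<close>

lemma gamma_tendsto_0: "\<gamma> \<longlonglongrightarrow> 0"
  using G by (simp add: assumption_G_def)

lemma multipliers_feasible: "dual_feasible P (\<mu> k (J k))"
  using S by (auto simp: assumption_S_def)

lemma duality_gap_nonneg:
  "0 \<le> model P 0 p y - dual_obj P N \<delta> (\<mu> k (J k)) p y"
proof -
  have "eqs P \<inter> ineqs P = {}" using nlp by (simp add: valid_nlp_def)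
  then show ?thesis
    unfolding duality_gap_eq
    using radius dual_norm_nonneg[OF norm_N] multiplier_le_viol[OF multipliers_feasible]
    by (intro add_nonneg_nonneg sum_nonneg mult_nonneg_nonneg) auto
qed

text \<open>The output test bounds this gap directly by \<open>(\<Delta>l + \<gamma>\<^sub>k) / \<beta>\<^sub>\<phi>\<close>.\<close>

lemma penalty_gap_tendsto_0:
  "(\<lambda>k. model P 0 (\<rho> k) (x k) - dual_obj P N \<delta> (\<mu> k (J k)) (\<rho> k) (x k)) \<longlonglongrightarrow> 0"
proof (rule Lim_null_comparison)
  have b: "0 < beta_phi A" using params by (simp add: valid_params_def)
  have "norm (model P 0 (\<rho> k) (x k) - dual_obj P N \<delta> (\<mu> k (J k)) (\<rho> k) (x k))
      \<le> (red k + \<gamma> k) / beta_phi A" for k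
  proof -
    let ?g = "model P 0 (\<rho> k) (x k) - dual_obj P N \<delta> (\<mu> k (J k)) (\<rho> k) (x k)"
    have "beta_phi A * (?g + \<gamma> k) \<le> red k + \<gamma> k"
      using output_ok_step[of k] by (simp add: output_ok_def)
    then have "?g + \<gamma> k \<le> (red k + \<gamma> k) / beta_phi A" using b by (simp add: field_simps)
    then show ?thesis using duality_gap_nonneg[of "\<rho> k" "x k" k] gamma_pos[of k] by simp
  qed
  then show "\<forall>\<^sub>F k in sequentially. norm (model P 0 (\<rho> k) (x k) - dual_obj P N \<delta> (\<mu> k (J k)) (\<rho> k) (x k))
      \<le> (red k + \<gamma> k) / beta_phi A" by simp
  have "(\<lambda>k. (red k + \<gamma> k) / beta_phi A) \<longlonglongrightarrow> (0 + 0) / beta_phi A"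
    by (intro tendsto_intros red_tendsto_0 gamma_tendsto_0) (use b in simp)
  then show "(\<lambda>k. (red k + \<gamma> k) / beta_phi A) \<longlonglongrightarrow> 0" by simp
qed

text \<open>The output test bounds this gap by the relaxed feasibility reduction, which the penalty update
  keeps below \<open>1 / \<beta>\<^sub>l\<close> times the relaxed penalty reduction. This is where the update rule prevents
  the penalty parameter from hiding a lack of progress towards feasibility.\<close>

lemma feasibility_gap_tendsto_0:
  "(\<lambda>k. model P 0 0 (x k) - dual_obj P N \<delta> (\<mu> k (J k)) 0 (x k)) \<longlonglongrightarrow> 0"
proof (rule Lim_null_comparison)
  have b: "0 < beta_v A" "0 < beta_l A" using params by (auto simp: valid_params_def)
  have "norm (model P 0 0 (x k) - dual_obj P N \<delta> (\<mu> k (J k)) 0 (x k))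
      \<le> (red k + \<gamma> k) / beta_l A / beta_v A" for k
  proof -
    let ?g = "model P 0 0 (x k) - dual_obj P N \<delta> (\<mu> k (J k)) 0 (x k)"
    let ?m = "model_red P (step k) 0 (x k) + \<gamma> k"
    have "beta_v A * (?g + \<gamma> k) \<le> ?m"
      using output_ok_step[of k] by (simp add: output_ok_def)
    moreover have "?m \<le> (red k + \<gamma> k) / beta_l A"
      using red_ge_feasibility_red[of k] b by (simp add: field_simps)
    ultimately have "beta_v A * (?g + \<gamma> k) \<le> (red k + \<gamma> k) / beta_l A" by linarith
    then have "?g + \<gamma> k \<le> (red k + \<gamma> k) / beta_l A / beta_v A"
      using b by (simp add: pos_le_divide_eq mult.commute)
    then show ?thesis using duality_gap_nonneg[of 0 "x k" k] gamma_pos[of k] by simp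
  qed
  then show "\<forall>\<^sub>F k in sequentially. norm (model P 0 0 (x k) - dual_obj P N \<delta> (\<mu> k (J k)) 0 (x k))
      \<le> (red k + \<gamma> k) / beta_l A / beta_v A" by simp
  have "(\<lambda>k. (red k + \<gamma> k) / beta_l A / beta_v A) \<longlonglongrightarrow> (0 + 0) / beta_l A / beta_v A"
    by (intro tendsto_intros red_tendsto_0 gamma_tendsto_0) (use b in auto)
  then show "(\<lambda>k. (red k + \<gamma> k) / beta_l A / beta_v A) \<longlonglongrightarrow> 0" by simp
qed

lemma limit_point_stationary:
  assumes "limit_point x z"
  shows "stationary_infeas P z"
proof -
  obtain s where s: "strict_mono s" "(\<lambda>k. x (s k)) \<longlonglongrightarrow> z"
    using assms by (auto simp: limit_point_def o_def)
  obtain l where l: "dual_feasible P l"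
    "0 *\<^sub>R grad (obj P) z + (\<Sum>i\<in>idx P. l i *\<^sub>R grad (con P i) z) = 0"
    "\<And>i. i \<in> idx P \<Longrightarrow> viol P i (con P i z) = l i * con P i z"
    using limit_multipliers[OF nlp norm_N radius s(2) tendsto_const multipliers_feasible
        LIMSEQ_subseq_LIMSEQ[OF feasibility_gap_tendsto_0 s(1), unfolded o_def]]
    by blast
  have "\<forall>i\<in>idx P. l i \<in> convex_subdiff (viol P i) (con P i z)"
    using multiplier_in_subdiff[OF l(1)] l(3) nlp by (auto simp: valid_nlp_def)
  then show ?thesis
    unfolding stationary_infeas_def infeas_subdiff_def using l(2) by (auto intro!: exI[of _ l])
qed

text \<open>At a feasible point all violations vanish, so the limiting complementarity identity becomes
  \<open>l\<^sub>i c\<^sub>i(z) = 0\<close>; dividing by \<open>\<rho>s\<close> normalizes the multiplier of the objective.\<close>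

lemma feasible_limit_point_kkt:
  assumes "limit_point x z" "feasible P z" and \<rho>s: "\<rho> \<longlonglongrightarrow> \<rho>s" "0 < \<rho>s"
  shows "kkt_point P z"
proof -
  obtain s where s: "strict_mono s" "(\<lambda>k. x (s k)) \<longlonglongrightarrow> z"
    using assms(1) by (auto simp: limit_point_def o_def)
  obtain l where l: "dual_feasible P l"
    "\<rho>s *\<^sub>R grad (obj P) z + (\<Sum>i\<in>idx P. l i *\<^sub>R grad (con P i) z) = 0"
    "\<And>i. i \<in> idx P \<Longrightarrow> viol P i (con P i z) = l i * con P i z"
    using limit_multipliers[OF nlp norm_N radius s(2)
        LIMSEQ_subseq_LIMSEQ[OF \<rho>s(1) s(1), unfolded o_def] multipliers_feasible
        LIMSEQ_subseq_LIMSEQ[OF penalty_gap_tendsto_0 s(1), unfolded o_def]]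
    by blast
  have disj: "eqs P \<inter> ineqs P = {}" using nlp by (simp add: valid_nlp_def)
  have "(1 / \<rho>s) *\<^sub>R (\<rho>s *\<^sub>R grad (obj P) z + (\<Sum>i\<in>idx P. l i *\<^sub>R grad (con P i) z)) = 0"
    using l(2) by simp
  then have "grad (obj P) z + (\<Sum>i\<in>idx P. (l i / \<rho>s) *\<^sub>R grad (con P i) z) = 0"
    using \<rho>s(2) by (simp add: scaleR_add_right scaleR_sum_right)
  moreover have "0 \<le> l i / \<rho>s \<and> l i / \<rho>s * con P i z = 0" if i: "i \<in> ineqs P" for i
  proof -
    have "viol P i (con P i z) = 0"
      using i disj assms(2) by (auto simp: viol_def feasible_def)
    then have "l i * con P i z = 0" using l(3)[of i] i by (simp add: idx_def)
    then show ?thesis using l(1) i \<rho>s(2) by (auto simp: dual_feasible_def)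
  qed
  ultimately show ?thesis
    unfolding kkt_point_def using assms(2) by (intro conjI exI[of _ "\<lambda>i. l i / \<rho>s"]) auto
qed

lemma infeas_convergent:
  assumes "\<rho> \<longlonglongrightarrow> 0"
  shows "convergent (\<lambda>k. infeas P (x k))"
proof -
  obtain B where B: "\<And>k. \<bar>obj P (x k)\<bar> \<le> B" using objective_bounded by blast
  obtain L where lim: "(\<lambda>k. \<rho> k * (obj P (x k) + B) + infeas P (x k)) \<longlonglongrightarrow> L"
    using shifted_penalty_convergent[OF B] unfolding convergent_def by blast
  have "(\<lambda>k. \<rho> k * (obj P (x k) + B)) \<longlonglongrightarrow> 0"
  proof (rule Lim_null_comparison)
    have "norm (\<rho> k * (obj P (x k) + B)) \<le> \<rho> k * (B + \<bar>B\<bar>)" for k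
      using rho_pos[of k] B[of k] by (simp add: abs_mult)
    then show "\<forall>\<^sub>F k in sequentially. norm (\<rho> k * (obj P (x k) + B)) \<le> \<rho> k * (B + \<bar>B\<bar>)" by simp
    show "(\<lambda>k. \<rho> k * (B + \<bar>B\<bar>)) \<longlonglongrightarrow> 0" using tendsto_mult_right[OF assms] by fastforce
  qed
  from tendsto_diff[OF lim this] show ?thesis by (auto simp: convergent_def)
qed

lemma infeas_tendsto:
  assumes "X \<longlonglongrightarrow> z"
  shows "(\<lambda>k. infeas P (X k)) \<longlonglongrightarrow> infeas P z"
proof -
  have "(\<lambda>k. con P i (X k)) \<longlonglongrightarrow> con P i z" if "i \<in> idx P" for i
  proof (rule isCont_tendsto_compose[OF _ assms])
    show "isCont (con P i) z"
      using nlp that unfolding valid_nlp_def cont_differentiable_def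
      by (blast intro: differentiable_imp_continuous_within)
  qed
  then have "(\<lambda>k. viol P i (con P i (X k))) \<longlonglongrightarrow> viol P i (con P i z)" if "i \<in> idx P" for i
    unfolding viol_def using that by (auto intro!: tendsto_intros)
  then show ?thesis unfolding infeas_def by (intro tendsto_sum)
qed

lemma limit_points_same_infeas:
  assumes "\<rho> \<longlonglongrightarrow> 0" "limit_point x y" "limit_point x z"
  shows "infeas P y = infeas P z"
proof -
  obtain L where L: "(\<lambda>k. infeas P (x k)) \<longlonglongrightarrow> L"
    using infeas_convergent[OF assms(1)] by (auto simp: convergent_def)
  have "infeas P w = L" if w: "limit_point x w" for w
  proof -
    obtain s where s: "strict_mono s" "(\<lambda>k. x (s k)) \<longlonglongrightarrow> w"
      using w by (auto simp: limit_point_def o_def)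
    show ?thesis
      using LIMSEQ_unique[OF infeas_tendsto[OF s(2)] LIMSEQ_subseq_LIMSEQ[OF L s(1), unfolded o_def]] .
  qed
  then show ?thesis using assms by simp
qed

end

theorem theorem3p9:
  fixes P :: "(real ^ 'n, 'i) nlp"
    and N :: "real ^ 'n \<Rightarrow> real"
    and \<delta> :: real
    and A :: fonco_params
    and x :: "nat \<Rightarrow> real ^ 'n"
    and \<rho> \<gamma> \<alpha> :: "nat \<Rightarrow> real"
    and J :: "nat \<Rightarrow> nat"
    and r :: "nat \<Rightarrow> nat \<Rightarrow> real"
    and d :: "nat \<Rightarrow> nat \<Rightarrow> real ^ 'n"
    and \<mu> \<nu> :: "nat \<Rightarrow> nat \<Rightarrow> 'i \<Rightarrow> real"
  assumes "valid_nlp P"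
    and "is_norm N" and "0 < \<delta>"
    and "valid_params A"
    and "fonco_run P N \<delta> A x \<rho> \<gamma> \<alpha> J r d \<mu> \<nu>"
    and "assumption_S P N \<delta> x J r d \<mu> \<nu>"
    and "assumption_G P x (\<lambda>k. d k (J k)) \<gamma>"
  shows "(\<forall>z. limit_point x z \<longrightarrow>
            stationary_infeas P z \<and> (feasible P z \<or> infeasible_stationary P z)) \<and>
         ((\<exists>\<rho>s>0. \<rho> \<longlonglongrightarrow> \<rho>s) \<and> (\<lambda>k. infeas P (x k)) \<longlonglongrightarrow> 0 \<longrightarrow>
            (\<forall>z. limit_point x z \<and> infeas P z = 0 \<longrightarrow> kkt_point P z)) \<and>
         (\<rho> \<longlonglongrightarrow> 0 \<longrightarrow>
            (\<forall>z. limit_point x z \<longrightarrow> feasible P z) \<or>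
            (\<forall>z. limit_point x z \<longrightarrow> \<not> feasible P z))"
proof -
  interpret fonco_execution P N \<delta> A x \<rho> \<gamma> \<alpha> J r d \<mu> \<nu>
    using assms by unfold_locales
  have feas: "infeas P z = 0 \<longleftrightarrow> feasible P z" for z
    using assms(1) by (intro infeas_eq_0_iff) (auto simp: valid_nlp_def idx_def)
  show ?thesis
  proof (intro conjI impI)
    have "feasible P z \<or> infeas P z > 0" for z
      using feas[of z] infeas_nonneg[of P z] by linarith
    then show "\<forall>z. limit_point x z \<longrightarrow>
        stationary_infeas P z \<and> (feasible P z \<or> infeasible_stationary P z)"
      using limit_point_stationary by (auto simp: infeasible_stationary_def)
  next
    assume "(\<exists>\<rho>s>0. \<rho> \<longlonglongrightarrow> \<rho>s) \<and> (\<lambda>k. infeas P (x k)) \<longlonglongrightarrow> 0"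
    then show "\<forall>z. limit_point x z \<and> infeas P z = 0 \<longrightarrow> kkt_point P z"
      using feasible_limit_point_kkt feas by blast
  next
    assume "\<rho> \<longlonglongrightarrow> 0"
    then show "(\<forall>z. limit_point x z \<longrightarrow> feasible P z) \<or> (\<forall>z. limit_point x z \<longrightarrow> \<not> feasible P z)"
      using limit_points_same_infeas feas by metis
  qed
qed

end
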